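(* The meet-taiga monoid $\mathbb{N}^*/{\equiv_{\mathrm{mTg}}}$ is presented by generators $\mathbb{N}$ and the relations $$\mathcal{R}_{\mathrm{mTg}} = \{ (b\,u\,ad\,v\,c,\; b\,u\,da\,v\,c) : a \leq d,\ b,c \in [a,d],\ u,v \in \mathbb{N}^* \},$$ where $a,b,c,d \in \mathbb{N}$. That is, the congruence $\equiv_{\mathrm{mTg}}$ is the monoid congruence on $\mathbb{N}^*$ generated by $\mathcal{R}_{\mathrm{mTg}}$.
   Context: $\mathbb{N}=\{1,2,\dots\}$ with its usual order, $\mathbb{N}^*$ is the free monoid of words over $\mathbb{N}$, and $[a,d]=\{k\in\mathbb{N}: a\le k\le d\}$. Define the following sets of pairs of words (with $a,b,c\in\mathbb{N}$, $u\in\mathbb{N}^*$): $\mathcal{R}_{\mathrm{sylv}}=\{(ca\,u\,b,\ ac\,u\,b): a\le b<c\}$, $\mathcal{R}_{\mathrm{sylv}^\#}=\{(b\,u\,ac,\ b\,u\,ca): a<b\le c\}$, $\mathcal{R}_{\mathrm{rSt}}=\{(ba\,u\,b,\ ab\,u\,b)\}$, $\mathcal{R}_{\mathrm{lSt}}=\{(b\,u\,ab,\ b\,u\,ba)\}$. The right-taiga congruence $\equiv_{\mathrm{rTg}}$ is the congruence on $\mathbb{N}^*$ generated by $\mathcal{R}_{\mathrm{sylv}}\cup\mathcal{R}_{\mathrm{rSt}}$, and the left-taiga congruence $\equiv_{\mathrm{lTg}}$ is the congruence generated by $\mathcal{R}_{\mathrm{sylv}^\#}\cup\mathcal{R}_{\mathrm{lSt}}$.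 Equivalently, $u\equiv_{\mathrm{rTg}}v$ (resp. $u\equiv_{\mathrm{lTg}}v$) iff inserting the letters of $u$ and of $v$, read from right to left (resp. left to right), into an initially empty binary search tree with multiplicities yields the same tree (inserting a letter already present increases by 1 the multiplicity of its node; otherwise it is added as a new leaf of multiplicity 1 in the usual binary search tree position). The meet-taiga congruence $\equiv_{\mathrm{mTg}}$ is the meet (intersection) of $\equiv_{\mathrm{rTg}}$ and $\equiv_{\mathrm{lTg}}$. *)

theory Defs
  imports Main
begin

text \<open>
  HOL's type nat contains 0, whereas the alphabet is {1, 2, ...}. Words are therefore
  lists over the carrier set of positive numbers; the monoid operation is append.
\<close>

definition letters :: "nat set" where
  "letters = {1..}"

definition words :: "nat list set" where
  "words = lists letters"

definition monoid_congruence :: "nat list rel \<Rightarrow> bool" where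
  "monoid_congruence E \<longleftrightarrow>
     equiv words E \<and>
     (\<forall>x y z w. (x, y) \<in> E \<longrightarrow> (z, w) \<in> E \<longrightarrow> (x @ z, y @ w) \<in> E)"

text \<open>
  The least congruence containing \<open>R\<close>. For \<open>R \<subseteq> words \<times> words\<close> the family is nonempty,
  because it contains \<open>words \<times> words\<close>.
\<close>

definition generated_congruence :: "nat list rel \<Rightarrow> nat list rel" where
  "generated_congruence R = \<Inter> {E. monoid_congruence E \<and> R \<subseteq> E}"

definition R_sylv :: "nat list rel" where
  "R_sylv = {([c, a] @ u @ [b], [a, c] @ u @ [b]) | a b c u.
     a \<in> letters \<and> b \<in> letters \<and> c \<in> letters \<and> u \<in> words \<and> a \<le> b \<and> b < c}"

definition R_sylv_sharp :: "nat list rel" where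
  "R_sylv_sharp = {([b] @ u @ [a, c], [b] @ u @ [c, a]) | a b c u.
     a \<in> letters \<and> b \<in> letters \<and> c \<in> letters \<and> u \<in> words \<and> a < b \<and> b \<le> c}"

definition R_rSt :: "nat list rel" where
  "R_rSt = {([b, a] @ u @ [b], [a, b] @ u @ [b]) | a b u.
     a \<in> letters \<and> b \<in> letters \<and> u \<in> words}"

definition R_lSt :: "nat list rel" where
  "R_lSt = {([b] @ u @ [a, b], [b] @ u @ [b, a]) | a b u.
     a \<in> letters \<and> b \<in> letters \<and> u \<in> words}"

definition rTg :: "nat list rel" where
  "rTg = generated_congruence (R_sylv \<union> R_rSt)"

definition lTg :: "nat list rel" where
  "lTg = generated_congruence (R_sylv_sharp \<union> R_lSt)"

definition mTg :: "nat list rel" where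
  "mTg = rTg \<inter> lTg"

definition R_mTg :: "nat list rel" where
  "R_mTg = {([b] @ u @ [a, d] @ v @ [c], [b] @ u @ [d, a] @ v @ [c]) | a b c d u v.
     a \<in> letters \<and> b \<in> letters \<and> c \<in> letters \<and> d \<in> letters \<and> u \<in> words \<and> v \<in> words \<and>
     a \<le> d \<and> b \<in> {a..d} \<and> c \<in> {a..d}}"

end

theory Submission
  imports Defs "HOL-Library.Multiset"
begin

text \<open>
  The right (left) relations exchange two adjacent letters \<open>a \<le> d\<close> exactly when some letter of
  \<open>[a, d]\<close> occurs further right (left). Hence the content of a word, together with the last (first)
  letter that it has in each interval, is invariant under the right-taiga (left-taiga) congruence.
  Conversely, let \<open>p @ s\<close> and \<open>p @ y # t\<close> agree in all these invariants, and let \<open>x y\<close> be the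
  factor of \<open>s\<close> that ends with the first \<open>y\<close> of \<open>s\<close>. The first and last letters in the interval
  spanned by \<open>x\<close> and \<open>y\<close> can only agree if that interval contains letters on both sides of the
  factor, so a meet-taiga relation moves \<open>y\<close> one step to the left; repeating this makes the
  common prefix longer.
\<close>

section \<open>Monoid congruences on words and the least one containing a relation\<close>

lemma monoid_congruenceI:
  assumes "E \<subseteq> words \<times> words"
    and "\<And>x. x \<in> words \<Longrightarrow> (x, x) \<in> E"
    and "\<And>x y. (x, y) \<in> E \<Longrightarrow> (y, x) \<in> E"
    and "\<And>x y z. (x, y) \<in> E \<Longrightarrow> (y, z) \<in> E \<Longrightarrow> (x, z) \<in> E"
    and "\<And>x y z w. (x, y) \<in> E \<Longrightarrow> (z, w) \<in> E \<Longrightarrow> (x @ z, y @ w) \<in> E"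
  shows "monoid_congruence E"
  unfolding monoid_congruence_def
proof (intro conjI allI impI)
  show "equiv words E"
  proof (rule equivI)
    show "refl_on words E" using assms(2) by (rule refl_onI)
    show "sym E" using assms(3) by (rule symI)
    show "trans E" using assms(4) by (rule transI)
  qed (fact assms(1))
qed (use assms(5) in blast)

lemma monoid_congruenceD:
  assumes "monoid_congruence E"
  shows "E \<subseteq> words \<times> words"
    and "x \<in> words \<Longrightarrow> (x, x) \<in> E"
    and "(x, y) \<in> E \<Longrightarrow> (y, x) \<in> E"
    and "(x, y) \<in> E \<Longrightarrow> (y, z) \<in> E \<Longrightarrow> (x, z) \<in> E"
    and "(x, y) \<in> E \<Longrightarrow> (z, w) \<in> E \<Longrightarrow> (x @ z, y @ w) \<in> E"
  using assms unfolding monoid_congruence_def equiv_def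
  by (auto dest: refl_onD symD transD)

lemma words_append [simp]: "u @ v \<in> words \<longleftrightarrow> u \<in> words \<and> v \<in> words"
  by (auto simp: words_def)

lemma words_Cons [simp]: "x # v \<in> words \<longleftrightarrow> x \<in> letters \<and> v \<in> words"
  by (auto simp: words_def)

lemma words_Nil [simp]: "[] \<in> words"
  by (simp add: words_def)

lemma words_rev [simp]: "rev u \<in> words \<longleftrightarrow> u \<in> words"
  by (auto simp: words_def)

lemma monoid_congruence_context:
  assumes "monoid_congruence E" "(x, y) \<in> E" "p \<in> words" "s \<in> words"
  shows "(p @ x @ s, p @ y @ s) \<in> E"
proof (rule monoid_congruenceD(5)[OF assms(1)])
  show "(p, p) \<in> E" using assms(1,3) by (rule monoid_congruenceD(2))
  have "(s, s) \<in> E" using assms(1,4) by (rule monoid_congruenceD(2))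
  with assms(1,2) show "(x @ s, y @ s) \<in> E" by (rule monoid_congruenceD(5))
qed

lemma monoid_congruence_generated:
  assumes "R \<subseteq> words \<times> words"
  shows "monoid_congruence (generated_congruence R)"
proof (rule monoid_congruenceI)
  have "monoid_congruence (words \<times> words)"
    by (rule monoid_congruenceI) auto
  then show "generated_congruence R \<subseteq> words \<times> words"
    using assms unfolding generated_congruence_def by blast
qed (auto simp: generated_congruence_def intro: monoid_congruenceD(2,3,5)
    dest: monoid_congruenceD(4))

lemma generated_congruence_superset: "R \<subseteq> generated_congruence R"
  unfolding generated_congruence_def by blast

lemma generated_congruence_least:
  "monoid_congruence E \<Longrightarrow> R \<subseteq> E \<Longrightarrow> generated_congruence R \<subseteq> E"
  unfolding generated_congruence_def by (rule Inter_lower) simp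

section \<open>Invariants: content and the first or last letter in each interval\<close>

lemma find_append:
  "find P (u @ v) = (case find P u of None \<Rightarrow> find P v | Some x \<Rightarrow> Some x)"
  by (induction u) auto

text \<open>\<open>None\<close> marks an interval that the word misses. Content is recorded
  separately because first letters do not count occurrences.\<close>

definition same_first :: "nat list rel" where
  "same_first = {(u, v). u \<in> words \<and> v \<in> words \<and> mset u = mset v \<and>
     (\<forall>a d. find (\<lambda>x. x \<in> {a..d}) u = find (\<lambda>x. x \<in> {a..d}) v)}"

definition same_last :: "nat list rel" where
  "same_last = {(u, v). (rev u, rev v) \<in> same_first}"

text \<open>Compatibility with products holds because the first hit in a product is that of the left
  factor or, failing that, of the right one.\<close>

lemma monoid_congruence_same_first: "monoid_congruence same_first"
  by (rule monoid_congruenceI) (auto simp: same_first_def find_append split: option.split)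

lemma monoid_congruence_same_last: "monoid_congruence same_last"
  by (rule monoid_congruenceI)
    (auto simp: same_last_def same_first_def find_append split: option.split)

text \<open>Exchanging two letters can only affect an interval containing both; it then contains
  \<open>b\<close> too, which occurs further left.\<close>

lemma lTg_subset: "lTg \<subseteq> same_first"
  unfolding lTg_def
proof (rule generated_congruence_least[OF monoid_congruence_same_first])
  show "R_sylv_sharp \<union> R_lSt \<subseteq> same_first"
    by (auto simp: same_first_def R_sylv_sharp_def R_lSt_def find_append split: option.split)
qed

lemma rTg_subset: "rTg \<subseteq> same_last"
  unfolding rTg_def
proof (rule generated_congruence_least[OF monoid_congruence_same_last])
  show "R_sylv \<union> R_rSt \<subseteq> same_last"
    by (auto simp: same_last_def same_first_def R_sylv_def R_rSt_def find_append
        split: option.split)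
qed

section \<open>Meet-taiga relations hold in both taiga congruences\<close>

lemma R_mTg_subset_rTg: "R_mTg \<subseteq> rTg"
proof clarify
  fix s t assume "(s, t) \<in> R_mTg"
  then obtain a b c d u v where st: "s = (b # u) @ [a, d] @ v @ [c]" "t = (b # u) @ [d, a] @ v @ [c]"
    and l: "a \<in> letters" "b \<in> letters" "c \<in> letters" "d \<in> letters" "u \<in> words" "v \<in> words"
    and c: "a \<le> c" "c \<le> d"
    by (auto simp: R_mTg_def)
  have "R_sylv \<union> R_rSt \<subseteq> words \<times> words"
    by (auto simp: R_sylv_def R_rSt_def)
  note cong = monoid_congruence_generated[OF this, folded rTg_def]
  have "([d, a] @ v @ [c], [a, d] @ v @ [c]) \<in> R_sylv \<union> R_rSt"
  \<comment> \<open>The right witness \<open>c\<close> selects the relation: \<open>R_rSt\<close> if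
    it equals \<open>d\<close>, otherwise \<open>R_sylv\<close> with
    \<open>a \<le> c < d\<close>.\<close>
  proof (cases "c = d")
    case True
    then show ?thesis using l unfolding R_rSt_def by blast
  next
    case False
    with c have "c < d" by simp
    then show ?thesis using l c unfolding R_sylv_def by blast
  qed
  then have "([d, a] @ v @ [c], [a, d] @ v @ [c]) \<in> rTg"
    using generated_congruence_superset unfolding rTg_def by blast
  then have "([a, d] @ v @ [c], [d, a] @ v @ [c]) \<in> rTg"
    by (rule monoid_congruenceD(3)[OF cong])
  then show "(s, t) \<in> rTg"
    using monoid_congruence_context[OF cong, of _ _ "b # u" "[]"] l by (simp add: st)
qed

lemma R_mTg_subset_lTg: "R_mTg \<subseteq> lTg"
proof clarify
  fix s t assume "(s, t) \<in> R_mTg"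
  then obtain a b c d u v where st: "s = ([b] @ u @ [a, d]) @ (v @ [c])"
      "t = ([b] @ u @ [d, a]) @ (v @ [c])"
    and l: "a \<in> letters" "b \<in> letters" "c \<in> letters" "d \<in> letters" "u \<in> words" "v \<in> words"
    and b: "a \<le> b" "b \<le> d"
    by (auto simp: R_mTg_def)
  have "R_sylv_sharp \<union> R_lSt \<subseteq> words \<times> words"
    by (auto simp: R_sylv_sharp_def R_lSt_def)
  note cong = monoid_congruence_generated[OF this, folded lTg_def]
  have sup: "R_sylv_sharp \<union> R_lSt \<subseteq> lTg"
    unfolding lTg_def by (rule generated_congruence_superset)
  have "([b] @ u @ [a, d], [b] @ u @ [d, a]) \<in> lTg"
  \<comment> \<open>Now the left witness decides. \<open>R_lSt\<close> with repeated letter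
    \<open>a\<close> is oriented the other way, hence the appeal to symmetry.\<close>
  proof (cases "b = a")
    case True
    then have "([b] @ u @ [d, a], [b] @ u @ [a, d]) \<in> R_lSt"
      using l unfolding R_lSt_def by blast
    with sup have "([b] @ u @ [d, a], [b] @ u @ [a, d]) \<in> lTg" by blast
    then show ?thesis by (rule monoid_congruenceD(3)[OF cong])
  next
    case False
    with b have "a < b" by simp
    then have "([b] @ u @ [a, d], [b] @ u @ [d, a]) \<in> R_sylv_sharp"
      using l b unfolding R_sylv_sharp_def by blast
    with sup show ?thesis by blast
  qed
  then show "(s, t) \<in> lTg"
    using monoid_congruence_context[OF cong, of "[b] @ u @ [a, d]" "[b] @ u @ [d, a]" "[]" "v @ [c]"]
      l by (simp add: st)
qed

section \<open>Deriving equality of words from equality of invariants\<close>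

lemma R_mTg_words: "R_mTg \<subseteq> words \<times> words"
  by (auto simp: R_mTg_def)

lemmas generated_mTg_congruence = monoid_congruence_generated[OF R_mTg_words]

lemma generated_mTg_subset: "generated_congruence R_mTg \<subseteq> same_first \<inter> same_last"
  using generated_congruence_least[OF monoid_congruence_same_first, of R_mTg]
    generated_congruence_least[OF monoid_congruence_same_last, of R_mTg]
    R_mTg_subset_lTg R_mTg_subset_rTg lTg_subset rTg_subset by blast

text \<open>The witnesses may sit anywhere in \<open>p\<close> and \<open>s\<close>: the letters
  beyond them become context. Using \<open>min\<close> and \<open>max\<close> covers both orders of
  \<open>x\<close> and \<open>y\<close>.\<close>

lemma swap_in_generated:
  assumes "p @ [x, y] @ s \<in> words"
    and "b \<in> set p" "b \<in> {min x y..max x y}"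
    and "c \<in> set s" "c \<in> {min x y..max x y}"
  shows "(p @ [x, y] @ s, p @ [y, x] @ s) \<in> generated_congruence R_mTg"
proof -
  note cong = generated_mTg_congruence
  obtain p1 u where p: "p = p1 @ b # u" using assms(2) by (meson split_list)
  obtain v s1 where s: "s = v @ c # s1" using assms(4) by (meson split_list)
  let ?l = "[b] @ u @ [x, y] @ v @ [c]" and ?r = "[b] @ u @ [y, x] @ v @ [c]"
  have l: "x \<in> letters" "y \<in> letters" "b \<in> letters" "c \<in> letters" "u \<in> words" "v \<in> words"
    and w: "p1 \<in> words" "s1 \<in> words"
    using assms(1) by (auto simp: p s)
  have "(?l, ?r) \<in> generated_congruence R_mTg"
  proof (cases "x \<le> y")
    case True
    then have "b \<in> {x..y}" "c \<in> {x..y}" using assms by auto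
    then have "(?l, ?r) \<in> R_mTg" using l True unfolding R_mTg_def by blast
    then show ?thesis using generated_congruence_superset by blast
  next
    case False
    then have "y \<le> x" "b \<in> {y..x}" "c \<in> {y..x}" using assms by auto
    then have "(?r, ?l) \<in> R_mTg" using l unfolding R_mTg_def by blast
    then show ?thesis
      by (rule monoid_congruenceD(3)[OF cong, OF subsetD[OF generated_congruence_superset]])
  qed
  then have "(p1 @ ?l @ s1, p1 @ ?r @ s1) \<in> generated_congruence R_mTg"
    using w by (rule monoid_congruence_context[OF cong])
  then show ?thesis by (simp add: p s)
qed

text \<open>Without a witness, the first letter in the interval would be \<open>x\<close> in one
  word and \<open>y\<close> in the other.\<close>

lemma witness_left:
  assumes "(p @ q @ [x, y] @ s, p @ y # t) \<in> same_first" "x \<noteq> y"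
  shows "\<exists>b \<in> set (p @ q). b \<in> {min x y..max x y}"
proof (rule ccontr)
  let ?P = "\<lambda>z. z \<in> {min x y..max x y}"
  assume "\<not> ?thesis"
  then have "find ?P p = None" "find ?P q = None" by (auto simp: find_None_iff)
  then have "find ?P (p @ q @ [x, y] @ s) = Some x" "find ?P (p @ y # t) = Some y"
    by (simp_all add: find_append)
  moreover have "find ?P (p @ q @ [x, y] @ s) = find ?P (p @ y # t)"
    using assms(1) by (auto simp: same_first_def)
  ultimately show False using assms(2) by simp
qed

text \<open>Without a witness, \<open>y\<close> is the last letter in the interval for the first
  word. In the second word that letter lies in \<open>t\<close>, a rearrangement of
  \<open>q @ x # s\<close>, which has an \<open>x\<close> but no \<open>y\<close>.\<close>

lemma witness_right:
  assumes "(p @ q @ [x, y] @ s, p @ y # t) \<in> same_last" "y \<notin> set q" "x \<noteq> y"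
  shows "\<exists>c \<in> set s. c \<in> {min x y..max x y}"
proof (rule ccontr)
  let ?P = "\<lambda>z. z \<in> {min x y..max x y}"
  assume none: "\<not> ?thesis"
  then have "find ?P (rev s) = None" by (auto simp: find_None_iff)
  then have "find ?P (rev (p @ q @ [x, y] @ s)) = Some y" by (simp add: find_append)
  moreover have "find ?P (rev (p @ q @ [x, y] @ s)) = find ?P (rev (p @ y # t))"
    using assms(1) by (auto simp: same_last_def same_first_def)
  ultimately have y: "find ?P (rev (p @ y # t)) = Some y" by simp
  have "mset (p @ q @ [x, y] @ s) = mset (p @ y # t)"
    using assms(1) by (auto simp: same_last_def same_first_def)
  then have "mset t = mset (q @ x # s)" by simp
  then have t: "set t = set (q @ x # s)" by (rule mset_eq_setD)
  \<comment> \<open>\<open>y\<close> is absent from \<open>s\<close> because it lies in the interval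
    itself.\<close>
  have "y \<notin> set t" using none assms(2,3) by (auto simp: t)
  have "x \<in> set (rev t)" "?P x" by (simp_all add: t)
  then have "find ?P (rev t) \<noteq> None" unfolding find_None_iff by blast
  then obtain z where z: "find ?P (rev t) = Some z" by blast
  then have "z \<in> set (rev t)" unfolding find_Some_iff by (metis nth_mem)
  then have "z \<in> set t" by simp
  with z y \<open>y \<notin> set t\<close> show False by (simp add: find_append)
qed

text \<open>Induction from the right end of \<open>q\<close>, since \<open>y\<close> first passes
  its immediate neighbour \<open>x\<close>, which then joins \<open>s\<close>.\<close>

lemma move_to_front:
  assumes "(p @ q @ y # s, p @ y # t) \<in> same_first \<inter> same_last" "y \<notin> set q"
  shows "(p @ q @ y # s, p @ y # q @ s) \<in> generated_congruence R_mTg"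
  using assms
proof (induction q arbitrary: s rule: rev_induct)
  case Nil
  then show ?case
    by (auto simp: same_first_def intro!: monoid_congruenceD(2)[OF generated_mTg_congruence])
next
  case (snoc x q)
  note cong = generated_mTg_congruence
  have ne: "x \<noteq> y" and q: "y \<notin> set q" using snoc.prems(2) by auto
  have f: "(p @ q @ [x, y] @ s, p @ y # t) \<in> same_first"
    and l: "(p @ q @ [x, y] @ s, p @ y # t) \<in> same_last"
    using snoc.prems(1) by auto
  from witness_left[OF f ne] obtain b where b: "b \<in> set (p @ q)" "b \<in> {min x y..max x y}" by blast
  from witness_right[OF l q ne] obtain c where c: "c \<in> set s" "c \<in> {min x y..max x y}" by blast
  have "(p @ q) @ [x, y] @ s \<in> words" using f by (auto simp: same_first_def)
  from swap_in_generated[OF this b c]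
  have step: "(p @ q @ [x, y] @ s, p @ q @ y # x # s) \<in> generated_congruence R_mTg" by simp
  \<comment> \<open>The swap preserves the invariants, so the induction hypothesis applies with
    \<open>x # s\<close> for \<open>s\<close>.\<close>
  have "(p @ q @ y # x # s, p @ y # t) \<in> same_first"
    using step f generated_mTg_subset
    by (meson IntD1 IntD2 monoid_congruenceD(3,4)[OF monoid_congruence_same_first] subsetD)
  moreover have "(p @ q @ y # x # s, p @ y # t) \<in> same_last"
    using step l generated_mTg_subset
    by (meson IntD1 IntD2 monoid_congruenceD(3,4)[OF monoid_congruence_same_last] subsetD)
  ultimately have "(p @ q @ y # x # s, p @ y # q @ x # s) \<in> generated_congruence R_mTg"
    using snoc.IH q by blast
  with step have "(p @ q @ [x, y] @ s, p @ y # q @ x # s) \<in> generated_congruence R_mTg"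
    by (rule monoid_congruenceD(4)[OF cong])
  then show ?case by simp
qed

lemma same_first_last_generated:
  assumes "(p @ s, p @ r) \<in> same_first \<inter> same_last"
  shows "(p @ s, p @ r) \<in> generated_congruence R_mTg"
  using assms
proof (induction r arbitrary: p s)
  case Nil
  \<comment> \<open>Equal content forces \<open>s\<close> to be empty.\<close>
  then show ?case
    by (auto simp: same_first_def intro!: monoid_congruenceD(2)[OF generated_mTg_congruence])
next
  case (Cons y t)
  have "mset s = mset (y # t)" using Cons.prems by (auto simp: same_first_def)
  then have "y \<in> set s" using mset_eq_setD by fastforce
  \<comment> \<open>Taking the first \<open>y\<close> keeps \<open>q\<close> free of
    \<open>y\<close>, as \<open>move_to_front\<close> requires.\<close>
  then obtain q s' where s: "s = q @ y # s'" and q: "y \<notin> set q" by (meson split_list_first)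
  have step: "(p @ s, p @ y # q @ s') \<in> generated_congruence R_mTg"
    using move_to_front[of p q y s' t] Cons.prems q by (simp add: s)
  have "(p @ y # q @ s', p @ y # t) \<in> same_first"
    using step Cons.prems generated_mTg_subset
    by (meson IntD1 IntD2 monoid_congruenceD(3,4)[OF monoid_congruence_same_first] subsetD)
  moreover have "(p @ y # q @ s', p @ y # t) \<in> same_last"
    using step Cons.prems generated_mTg_subset
    by (meson IntD1 IntD2 monoid_congruenceD(3,4)[OF monoid_congruence_same_last] subsetD)
  ultimately have "(p @ y # q @ s', p @ y # t) \<in> generated_congruence R_mTg"
    using Cons.IH[of "p @ [y]" "q @ s'"] by simp
  with step show ?case by (rule monoid_congruenceD(4)[OF generated_mTg_congruence])
qed

theorem proposition3p3:
  shows "mTg = generated_congruence R_mTg"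
proof
  \<comment> \<open>Words congruent on both sides share all invariants; start from the empty common
    prefix.\<close>
  show "mTg \<subseteq> generated_congruence R_mTg"
    using same_first_last_generated[of "[]"] lTg_subset rTg_subset
    by (auto simp: mTg_def)
  have "monoid_congruence rTg" "monoid_congruence lTg"
    unfolding rTg_def lTg_def
    by (rule monoid_congruence_generated,
        auto simp: R_sylv_def R_rSt_def R_sylv_sharp_def R_lSt_def)+
  then show "generated_congruence R_mTg \<subseteq> mTg"
    using generated_congruence_least R_mTg_subset_rTg R_mTg_subset_lTg
    by (simp add: mTg_def)
qed

end
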